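(* Let $F$ be a field, $k$ its prime field, and let $O\subseteq F\setminus\{0,1\}$ be a non-empty subset which is $\mathrm{Aut}(F)$-invariant. Suppose that (1) $k(O)\subsetneq F$, and (2) if $\mathrm{char}(F)=2$ then $F$ is perfect and $|F|>4$. Then the group of $O$-preserving permutations of $F\cup\{\infty\}$ is exactly $P\Gamma L_2(F)$.
   Context: For a field $F$, $F\cup\{\infty\}$ is the projective line over $F$. The cross-ratio of four distinct points $a,b,c,d\in F\cup\{\infty\}$ is $[a,b;c,d]=\frac{c-a}{c-b}\cdot\frac{d-b}{d-a}\in F\setminus\{0,1\}$, with the usual conventions for $\infty$ (if one of the points is $\infty$, the two factors containing it are cancelled). A permutation $f$ of $F\cup\{\infty\}$ is $O$-preserving if for all distinct $a,b,c,d\in F\cup\{\infty\}$: $[a,b;c,d]\in O \iff [f(a),f(b);f(c),f(d)]\in O$. $\mathrm{Aut}(F)$ is the group of field automorphisms of $F$, and $O$ is $\mathrm{Aut}(F)$-invariant if $\sigma(O)=O$ for all $\sigma\in\mathrm{Aut}(F)$. $k(O)$ is the subfield of $F$ generated by $O$ (over the prime field $k$). $P\Gamma L_2(F)$ is the group of permutations of $F\cup\{\infty\}$ of the form $x\mapsto\frac{ax^\sigma+b}{cx^\sigma+d}$ with $a,b,c,d\in F$, $ad-bc\neq 0$, $\sigma\in\mathrm{Aut}(F)$, where $x^\sigma=\sigma(x)$, $\infty^\sigma=\infty$, and the usual conventions for $\infty$ and fractions apply. *)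

theory Defs
  imports "HOL-Algebra.Algebraic_Closure_Type" "HOL-Algebra.Generated_Fields"
begin

text \<open>The projective line over the field \<^typ>\<open>'a\<close>, that is, the field with a point at infinity
  added.\<close>

datatype 'a proj_line = Pt 'a | Infty

text \<open>A factor of the cross-ratio. A factor that involves \<^term>\<open>Infty\<close> is replaced by 1:
  if exactly one of the four points is \<^term>\<open>Infty\<close>, then it occurs in one factor of the
  numerator and in one factor of the denominator, and these two factors cancel.\<close>

fun cr_factor :: "'a::field proj_line \<Rightarrow> 'a proj_line \<Rightarrow> 'a" where
  "cr_factor (Pt x) (Pt y) = x - y"
| "cr_factor _ _ = 1"

text \<open>Only meaningful for four distinct points.\<close>

definition cross_ratio ::
    "'a::field proj_line \<Rightarrow> 'a proj_line \<Rightarrow> 'a proj_line \<Rightarrow> 'a proj_line \<Rightarrow> 'a" where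
  "cross_ratio a b c d =
     (cr_factor c a / cr_factor c b) * (cr_factor d b / cr_factor d a)"

definition cr_preserving_perms ::
    "'a::field set \<Rightarrow> ('a proj_line \<Rightarrow> 'a proj_line) set" where
  "cr_preserving_perms S =
     {f. bij f \<and>
         (\<forall>a b c d. distinct [a, b, c, d] \<longrightarrow>
            (cross_ratio a b c d \<in> S \<longleftrightarrow> cross_ratio (f a) (f b) (f c) (f d) \<in> S))}"

definition field_auts :: "('a::field \<Rightarrow> 'a) set" where
  "field_auts = ring_iso ring_of_type_algebra ring_of_type_algebra"

definition aut_invariant :: "'a::field set \<Rightarrow> bool" where
  "aut_invariant S \<longleftrightarrow> (\<forall>\<sigma>\<in>field_auts. \<sigma> ` S = S)"

text \<open>Being closed under the field operations and containing 1, this contains the prime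
  field.\<close>

definition gen_subfield :: "'a::field set \<Rightarrow> 'a set" where
  "gen_subfield S = generate_field ring_of_type_algebra S"

definition perfect_field :: "'a::field itself \<Rightarrow> bool" where
  "perfect_field _ \<longleftrightarrow> CHAR('a) = 0 \<or> surj (\<lambda>x::'a. x ^ CHAR('a))"

fun frac_linear ::
    "'a::field \<Rightarrow> 'a \<Rightarrow> 'a \<Rightarrow> 'a \<Rightarrow> 'a proj_line \<Rightarrow> 'a proj_line" where
  "frac_linear a b c d (Pt x) =
     (if c * x + d = 0 then Infty else Pt ((a * x + b) / (c * x + d)))"
| "frac_linear a b c d Infty = (if c = 0 then Infty else Pt (a / c))"

text \<open>The map \<^term>\<open>map_proj_line \<sigma>\<close> applies \<open>\<sigma>\<close> to the finite points and
  fixes \<^term>\<open>Infty\<close>.\<close>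

definition PGammaL2 :: "('a::field proj_line \<Rightarrow> 'a proj_line) set" where
  "PGammaL2 =
     {frac_linear a b c d \<circ> map_proj_line \<sigma> | a b c d \<sigma>.
        a * d - b * c \<noteq> 0 \<and> \<sigma> \<in> field_auts}"

end

theory Submission
  imports Defs
begin

text \<open>Let \<open>K\<close> be the subfield generated by \<open>S\<close>. A set of points is closed if, with three distinct
  points, it contains every fourth point whose cross-ratio with them lies in \<open>S\<close>. Maps that preserve
  the relation given by \<open>S\<close> map closures to closures. The closure of \<open>{\<infinity>, 0, 1}\<close> is therefore
  invariant under \<open>x \<mapsto> 1 / x\<close>, \<open>x \<mapsto> 1 - x\<close> and multiplication by its own nonzero points, so that it
  is \<open>K \<union> {\<infinity>}\<close>, and the relation given by \<open>K\<close> is preserved as well.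

  After composition with a linear fractional map, the permutation fixes \<open>\<infinity>\<close>, \<open>0\<close>, \<open>1\<close>. On the
  finite points it is then a map \<open>\<phi>\<close> that preserves collinearity in the vector space \<open>F\<close> over \<open>K\<close>,
  whose dimension is at least 2, and \<open>K\<close> has more than two elements; hence \<open>\<phi>\<close> is additive. The same
  holds for \<open>x \<mapsto> 1 / \<phi> (1 / x)\<close>, and Hua's identity shows that \<open>\<phi>\<close> is multiplicative.\<close>

section \<open>Subfields\<close>

text \<open>Differences and quotients generate the other operations. Since \<open>x / 0 = 0\<close>
  lies in \<open>K\<close>, \<open>divide_mem\<close> can be stated for all
  \<open>y\<close>.\<close>

locale type_subfield =
  fixes K :: "'a::field set"
  assumes one_mem: "1 \<in> K"
    and diff_mem: "x \<in> K \<Longrightarrow> y \<in> K \<Longrightarrow> x - y \<in> K"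
    and divide_mem: "x \<in> K \<Longrightarrow> y \<in> K \<Longrightarrow> x / y \<in> K"
begin

lemma zero_mem: "0 \<in> K"
  using diff_mem[OF one_mem one_mem] by simp

lemma add_mem: "x \<in> K \<Longrightarrow> y \<in> K \<Longrightarrow> x + y \<in> K"
  using diff_mem[of x "0 - y"] diff_mem[OF zero_mem, of y] by simp

lemma mult_mem: "x \<in> K \<Longrightarrow> y \<in> K \<Longrightarrow> x * y \<in> K"
  using divide_mem[of x "1 / y"] divide_mem[OF one_mem, of y] by simp

lemmas closed = zero_mem one_mem diff_mem divide_mem add_mem mult_mem

end

section \<open>The generated subfield in terms of the type-class operations\<close>

lemma minus_ring_of_type_algebra [simp]:
  "\<ominus>\<^bsub>ring_of_type_algebra\<^esub> x = - (x :: 'a::field)"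
proof -
  have "(THE y. x + y = 0 \<and> y + x = 0) = - x"
    by (rule the_equality) (auto simp: eq_neg_iff_add_eq_0)
  then show ?thesis
    by (simp add: a_inv_def m_inv_def ring_of_type_algebra_def)
qed

lemma inv_ring_of_type_algebra [simp]:
  assumes "x \<noteq> 0"
  shows "inv\<^bsub>ring_of_type_algebra\<^esub> x = inverse (x :: 'a::field)"
proof -
  have "(THE y. x * y = 1 \<and> y * x = 1) = inverse x"
    by (rule the_equality) (use assms in \<open>auto simp: field_simps\<close>)
  then show ?thesis
    by (simp add: m_inv_def ring_of_type_algebra_def)
qed

lemma ring_of_type_algebra_simps [simp]:
  "\<one>\<^bsub>ring_of_type_algebra\<^esub> = 1"
  "\<zero>\<^bsub>ring_of_type_algebra\<^esub> = 0"
  "x \<oplus>\<^bsub>ring_of_type_algebra\<^esub> y = x + y"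
  "x \<otimes>\<^bsub>ring_of_type_algebra\<^esub> y = x * y"
  "carrier ring_of_type_algebra = UNIV"
  by (simp_all add: ring_of_type_algebra_def)

lemma gen_subfield_superset: "S \<subseteq> gen_subfield S"
  by (auto simp: gen_subfield_def intro: generate_field.incl)

lemma type_subfield_gen_subfield: "type_subfield (gen_subfield (S :: 'a::field set))"
proof
  show "1 \<in> gen_subfield S"
    using generate_field.one[of "ring_of_type_algebra :: 'a ring" S] by (simp add: gen_subfield_def)
  have add: "x + y \<in> gen_subfield S" if "x \<in> gen_subfield S" "y \<in> gen_subfield S" for x y
    using generate_field.eng_add[of x "ring_of_type_algebra :: 'a ring" S y] that
    by (simp add: gen_subfield_def)
  have minus: "- x \<in> gen_subfield S" if "x \<in> gen_subfield S" for x
    using generate_field.a_inv[of x "ring_of_type_algebra :: 'a ring" S] that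
    by (simp add: gen_subfield_def)
  have mult: "x * y \<in> gen_subfield S" if "x \<in> gen_subfield S" "y \<in> gen_subfield S" for x y
    using generate_field.eng_mult[of x "ring_of_type_algebra :: 'a ring" S y] that
    by (simp add: gen_subfield_def)
  have inv: "inverse x \<in> gen_subfield S" if "x \<in> gen_subfield S" for x
    using generate_field.m_inv[of x "ring_of_type_algebra :: 'a ring" S] that
    by (cases "x = 0") (simp_all add: gen_subfield_def)
  show "x - y \<in> gen_subfield S" if "x \<in> gen_subfield S" "y \<in> gen_subfield S" for x y
    using add[OF that(1) minus[OF that(2)]] by simp
  show "x / y \<in> gen_subfield S" if "x \<in> gen_subfield S" "y \<in> gen_subfield S" for x y
    using mult[OF that(1) inv[OF that(2)]] by (simp add: divide_inverse)
qed

lemma gen_subfield_minimal: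
  assumes "type_subfield E" and "S \<subseteq> E"
  shows "gen_subfield S \<subseteq> E"
proof
  interpret type_subfield E by fact
  fix x
  assume "x \<in> gen_subfield S"
  then show "x \<in> E"
    unfolding gen_subfield_def
  proof (induction rule: generate_field.induct)
    case (incl h)
    then show ?case using assms(2) by auto
  next
    case (a_inv h)
    then show ?case using diff_mem[OF zero_mem] by force
  next
    case (m_inv h)
    then show ?case using divide_mem[OF one_mem] by (simp add: inverse_eq_divide)
  qed (auto intro: closed)
qed

lemma field_auts_iff:
  "\<sigma> \<in> field_auts \<longleftrightarrow> bij \<sigma> \<and> (\<forall>x y. \<sigma> (x + y) = \<sigma> x + \<sigma> y) \<and>
     (\<forall>x y. \<sigma> (x * y) = \<sigma> x * \<sigma> y) \<and> \<sigma> (1 :: 'a::field) = 1"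
  by (auto simp: field_auts_def ring_iso_def ring_hom_def)

section \<open>Linear fractional maps preserve cross-ratios\<close>

text \<open>The determinant of homogeneous coordinates, with \<open>Pt x\<close> given by \<open>(x, 1)\<close> and \<open>Infty\<close> by \<open>(1, 0)\<close>.
  The matrix of a linear fractional map sends the coordinates of \<open>p\<close> to \<open>proj_weight p\<close> times those of
  the image of \<open>p\<close>; these weights cancel in a cross-ratio.\<close>

fun proj_det :: "'a::field proj_line \<Rightarrow> 'a proj_line \<Rightarrow> 'a" where
  "proj_det (Pt x) (Pt y) = x - y"
| "proj_det (Pt x) Infty = -1"
| "proj_det Infty (Pt y) = 1"
| "proj_det Infty Infty = 0"

lemma proj_det_eq_0_iff [simp]: "proj_det p q = 0 \<longleftrightarrow> p = q"
  by (cases p; cases q) auto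

text \<open>Each point occurs once in the numerator and once in the denominator, in the same
  argument position, so the signs that \<open>proj_det\<close> gives to \<open>Infty\<close>
  cancel.\<close>

lemma cross_ratio_eq_proj_det:
  assumes "distinct [p, q, r, s]"
  shows "cross_ratio p q r s =
    (proj_det r p / proj_det r q) * (proj_det s q / proj_det s p)"
  using assms by (cases p; cases q; cases r; cases s) (auto simp: cross_ratio_def divide_simps)

fun proj_weight :: "'a::field \<Rightarrow> 'a \<Rightarrow> 'a \<Rightarrow> 'a \<Rightarrow> 'a proj_line \<Rightarrow> 'a" where
  "proj_weight a b c d (Pt x) = (if c * x + d = 0 then a * x + b else c * x + d)"
| "proj_weight a b c d Infty = (if c = 0 then a else c)"

text \<open>The two homogeneous coordinates of an image cannot both vanish, because the determinant
  of the matrix is a combination of them.\<close>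

lemma proj_weight_nonzero:
  fixes a b c d :: "'a::field"
  assumes "a * d - b * c \<noteq> 0"
  shows "proj_weight a b c d p \<noteq> 0"
proof (cases p)
  case (Pt x)
  have "a * (c * x + d) - c * (a * x + b) = a * d - b * c"
    "(c * x + d) * b - d * (a * x + b) = x * (b * c - a * d)"
    by (auto simp: algebra_simps)
  then show ?thesis
    using Pt assms by (auto split: if_splits)
next
  case Infty
  then show ?thesis using assms by auto
qed

text \<open>This is multiplicativity of 2x2 determinants, with the image coordinates rescaled to the
  normal form \<open>(x, 1)\<close> or \<open>(1, 0)\<close>.\<close>

lemma proj_det_frac_linear:
  fixes a b c d :: "'a::field"
  assumes "a * d - b * c \<noteq> 0"
  shows "proj_weight a b c d p * proj_weight a b c d q *
      proj_det (frac_linear a b c d p) (frac_linear a b c d q) =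
    (a * d - b * c) * proj_det p q"
proof (cases p; cases q)
  fix x y
  assume p: "p = Pt x" and q: "q = Pt y"
  have *: "(a * x + b) * (c * y + d) - (a * y + b) * (c * x + d) = (a * d - b * c) * (x - y)"
    by (simp add: algebra_simps)
  show ?thesis
  proof (cases "c * x + d = 0"; cases "c * y + d = 0")
    assume "c * x + d = 0" "c * y + d = 0"
    then have "(a * d - b * c) * (x - y) = 0" using * by simp
    then have "x = y" using assms by simp
    then show ?thesis using p q \<open>c * x + d = 0\<close> by simp
  next
    assume "c * x + d = 0" "c * y + d \<noteq> 0"
    then show ?thesis using p q * by simp
  next
    assume "c * x + d \<noteq> 0" "c * y + d = 0"
    then show ?thesis using p q * by (simp add: algebra_simps)
  next
    assume A: "c * x + d \<noteq> 0" "c * y + d \<noteq> 0"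
    then have "(c * x + d) * (c * y + d) * ((a * x + b) / (c * x + d) - (a * y + b) / (c * y + d)) =
        (a * x + b) * (c * y + d) - (a * y + b) * (c * x + d)"
      by (simp add: divide_simps)
    then show ?thesis using A p q * by simp
  qed
next
  fix x
  assume p: "p = Pt x" and q: "q = Infty"
  have *: "(a * x + b) * c - a * (c * x + d) = - (a * d - b * c)"
    by (simp add: algebra_simps)
  show ?thesis
  proof (cases "c = 0"; cases "c * x + d = 0")
    assume A: "c \<noteq> 0" "c * x + d \<noteq> 0"
    then have "(c * x + d) * c * ((a * x + b) / (c * x + d) - a / c) =
        (a * x + b) * c - a * (c * x + d)"
      by (simp add: divide_simps)
    then show ?thesis using A p q * by simp
  qed (use assms p q * in \<open>auto simp: algebra_simps\<close>)
next
  fix y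
  assume p: "p = Infty" and q: "q = Pt y"
  have *: "a * (c * y + d) - (a * y + b) * c = a * d - b * c"
    by (simp add: algebra_simps)
  show ?thesis
  proof (cases "c = 0"; cases "c * y + d = 0")
    assume A: "c \<noteq> 0" "c * y + d \<noteq> 0"
    then have "c * (c * y + d) * (a / c - (a * y + b) / (c * y + d)) =
        a * (c * y + d) - (a * y + b) * c"
      by (simp add: divide_simps)
    then show ?thesis using A p q * by simp
  qed (use assms p q * in \<open>auto simp: algebra_simps\<close>)
qed simp

lemma frac_linear_eq_iff:
  fixes a b c d :: "'a::field"
  assumes "a * d - b * c \<noteq> 0"
  shows "frac_linear a b c d p = frac_linear a b c d q \<longleftrightarrow> p = q"
  using proj_det_frac_linear[OF assms, of p q] proj_weight_nonzero[OF assms] assms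
  by (metis mult_eq_0_iff proj_det_eq_0_iff)

text \<open>The adjugate matrix is a scalar multiple of the inverse matrix, and scalars do not
  affect the map.\<close>

lemma frac_linear_inverse:
  fixes a b c d :: "'a::field"
  assumes "a * d - b * c \<noteq> 0"
  shows "frac_linear d (- b) (- c) a (frac_linear a b c d p) = p"
proof (cases p)
  case (Pt x)
  show ?thesis
  proof (cases "c * x + d = 0")
    case True
    have "c \<noteq> 0" using True assms by auto
    moreover have "d = - (c * x)" using True by (simp add: eq_neg_iff_add_eq_0 add.commute)
    ultimately show ?thesis using Pt True by simp
  next
    case False
    have 1: "- c * ((a * x + b) / (c * x + d)) + a = (a * d - b * c) / (c * x + d)"
      using False by (simp add: divide_simps) (simp add: algebra_simps)
    have 2: "d * ((a * x + b) / (c * x + d)) + - b = x * (a * d - b * c) / (c * x + d)"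
      using False by (simp add: divide_simps) (simp add: algebra_simps)
    show ?thesis using Pt False 1 2 assms by simp
  qed
next
  case Infty
  then show ?thesis using assms by (cases "c = 0") auto
qed

lemma bij_frac_linear:
  fixes a b c d :: "'a::field"
  assumes "a * d - b * c \<noteq> 0"
  shows "bij (frac_linear a b c d)"
proof (rule o_bij)
  show "frac_linear d (- b) (- c) a \<circ> frac_linear a b c d = id"
    using frac_linear_inverse[OF assms] by (simp add: fun_eq_iff)
  have "d * a - (- b) * (- c) \<noteq> 0" using assms by (simp add: mult.commute)
  from frac_linear_inverse[OF this]
  show "frac_linear a b c d \<circ> frac_linear d (- b) (- c) a = id"
    by (simp add: fun_eq_iff)
qed

lemma cross_ratio_frac_linear:
  fixes a b c d :: "'a::field"
  assumes det: "a * d - b * c \<noteq> 0" and dist: "distinct [p, q, r, s]"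
  defines "m \<equiv> frac_linear a b c d"
  shows "cross_ratio (m p) (m q) (m r) (m s) = cross_ratio p q r s"
proof -
  let ?u = "proj_weight a b c d"
  have u: "?u x \<noteq> 0" for x by (rule proj_weight_nonzero[OF det])
  have D: "proj_det (m x) (m y) = (a * d - b * c) * proj_det x y / (?u x * ?u y)" for x y
    using proj_det_frac_linear[OF det, of x y] u[of x] u[of y]
    by (simp add: m_def field_simps)
  have "distinct [m p, m q, m r, m s]"
    using dist by (auto simp: m_def frac_linear_eq_iff[OF det])
  then show ?thesis
    using dist u[of p] u[of q] u[of r] u[of s] det
    by (simp add: cross_ratio_eq_proj_det D)
qed

lemma frac_linear_in_cr_preserving_perms:
  fixes a b c d :: "'a::field"
  assumes "a * d - b * c \<noteq> 0"
  shows "frac_linear a b c d \<in> cr_preserving_perms S"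
  unfolding cr_preserving_perms_def
  using bij_frac_linear[OF assms] cross_ratio_frac_linear[OF assms] by simp

lemma frac_linear_normalize:
  assumes "distinct [p, q, r :: 'a::field proj_line]"
  obtains a b c d where "a * d - b * c \<noteq> 0" "frac_linear a b c d p = Infty"
    "frac_linear a b c d q = Pt 0" "frac_linear a b c d r = Pt 1"
proof (cases p; cases q; cases r)
  fix x y z
  assume "p = Pt x" "q = Pt y" "r = Pt z"
  moreover have "(z - x) * (- x * (z - y)) - (z - x) * (- y) * (z - y) = (z - x) * (z - y) * (y - x)"
    "(z - x) * y + (z - x) * (- y) = 0" "(z - y) * x + - x * (z - y) = 0"
    "(z - y) * y + - x * (z - y) = (z - y) * (y - x)"
    "(z - x) * z + (z - x) * (- y) = (z - x) * (z - y)"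
    "(z - y) * z + - x * (z - y) = (z - x) * (z - y)"
    by (simp_all add: algebra_simps)
  ultimately show thesis
    \<comment> \<open>The map is \<open>v\<close> to the cross-ratio of \<open>p\<close>,
      \<open>q\<close>, \<open>r\<close>, \<open>v\<close>, with denominators cleared. The remaining
      cases use the same map with the factors at \<open>Infty\<close> dropped.\<close>
    using assms that[where a = "z - x" and b = "(z - x) * (- y)" and c = "z - y" and d = "- x * (z - y)"]
    by auto
next
  fix x y
  assume "p = Pt x" "q = Pt y" "r = Infty"
  then show thesis
    \<comment> \<open>Positional arguments stand for \<open>a\<close>, \<open>d\<close>,
      \<open>b\<close>, \<open>c\<close>, the order of occurrence in the determinant.\<close>
    using assms that[of 1 "- x" "- y" 1] by auto
next
  fix x z
  assume "p = Pt x" "q = Infty" "r = Pt z"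
  then show thesis
    using assms that[of 0 "- x" "z - x" 1] by auto
next
  fix y z
  assume "p = Infty" "q = Pt y" "r = Pt z"
  then show thesis
    using assms that[of 1 "z - y" "- y" 0] by (auto simp: field_simps)
qed (use assms in auto)

section \<open>Closure under prescribed cross-ratios\<close>

lemma comp_in_cr_preserving_perms:
  assumes "f \<in> cr_preserving_perms S" "g \<in> cr_preserving_perms S"
  shows "f \<circ> g \<in> cr_preserving_perms S"
proof -
  have "bij f" "bij g" and f: "\<And>a b c d. distinct [a, b, c, d] \<Longrightarrow>
      cross_ratio a b c d \<in> S \<longleftrightarrow> cross_ratio (f a) (f b) (f c) (f d) \<in> S"
    and g: "\<And>a b c d. distinct [a, b, c, d] \<Longrightarrow>
      cross_ratio a b c d \<in> S \<longleftrightarrow> cross_ratio (g a) (g b) (g c) (g d) \<in> S"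
    using assms unfolding cr_preserving_perms_def by blast+
  then have "bij (f \<circ> g)" "inj g" by (auto simp: bij_is_inj intro: bij_comp)
  moreover have "cross_ratio a b c d \<in> S \<longleftrightarrow>
      cross_ratio (f (g a)) (f (g b)) (f (g c)) (f (g d)) \<in> S" if "distinct [a, b, c, d]" for a b c d
    using f[of "g a" "g b" "g c" "g d"] g[OF that] that \<open>inj g\<close> by (simp add: inj_eq)
  ultimately show ?thesis by (simp add: cr_preserving_perms_def)
qed

lemma inv_in_cr_preserving_perms:
  assumes "f \<in> cr_preserving_perms S"
  shows "inv_into UNIV f \<in> cr_preserving_perms S"
proof -
  have f: "bij f" "\<And>a b c d. distinct [a, b, c, d] \<Longrightarrow>
      cross_ratio a b c d \<in> S \<longleftrightarrow> cross_ratio (f a) (f b) (f c) (f d) \<in> S"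
    using assms unfolding cr_preserving_perms_def by blast+
  have "bij (inv_into UNIV f)" using f(1) by (rule bij_imp_bij_inv)
  moreover have "cross_ratio a b c d \<in> S \<longleftrightarrow>
      cross_ratio (inv_into UNIV f a) (inv_into UNIV f b) (inv_into UNIV f c) (inv_into UNIV f d) \<in> S" if "distinct [a, b, c, d]" for a b c d
    using f(2)[of "inv_into UNIV f a" "inv_into UNIV f b" "inv_into UNIV f c" "inv_into UNIV f d"] that
      bij_is_inj[OF \<open>bij (inv_into UNIV f)\<close>] f(1)
    by (simp add: inj_eq bij_inv_eq_iff surj_f_inv_f[OF bij_is_surj])
  ultimately show ?thesis by (auto simp: cr_preserving_perms_def)
qed

section \<open>Closed point sets and hulls\<close>

definition cr_closed :: "'a::field set \<Rightarrow> 'a proj_line set \<Rightarrow> bool" where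
  "cr_closed S T \<longleftrightarrow> (\<forall>x\<in>T. \<forall>y\<in>T. \<forall>z\<in>T. \<forall>w. distinct [x, y, z, w] \<longrightarrow>
     cross_ratio x y z w \<in> S \<longrightarrow> w \<in> T)"

definition cr_hull :: "'a::field set \<Rightarrow> 'a proj_line set \<Rightarrow> 'a proj_line set" where
  "cr_hull S A = \<Inter>{T. A \<subseteq> T \<and> cr_closed S T}"

lemma cr_hull_superset: "A \<subseteq> cr_hull S A"
  by (auto simp: cr_hull_def)

lemma cr_closed_cr_hull: "cr_closed S (cr_hull S A)"
proof -
  have *: "cr_closed S (\<Inter>\<T>)" if closed: "\<And>T. T \<in> \<T> \<Longrightarrow> cr_closed S T" for \<T>
    unfolding cr_closed_def
  proof (intro ballI allI impI InterI)
    fix x y z w T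
    assume "x \<in> \<Inter>\<T>" "y \<in> \<Inter>\<T>" "z \<in> \<Inter>\<T>" "distinct [x, y, z, w]" "cross_ratio x y z w \<in> S"
      and T: "T \<in> \<T>"
    then show "w \<in> T"
      using closed[OF T] InterD[OF _ T] unfolding cr_closed_def by blast
  qed
  show ?thesis unfolding cr_hull_def by (rule *) simp
qed

lemma cr_hull_minimal: "A \<subseteq> T \<Longrightarrow> cr_closed S T \<Longrightarrow> cr_hull S A \<subseteq> T"
  unfolding cr_hull_def by (rule Inter_lower) simp

lemma cr_closed_image:
  assumes "f \<in> cr_preserving_perms S" and "cr_closed S T"
  shows "cr_closed S (f ` T)"
  unfolding cr_closed_def
proof (intro ballI allI impI)
  fix x y z w
  assume "x \<in> f ` T" "y \<in> f ` T" "z \<in> f ` T" and *: "distinct [x, y, z, w]" "cross_ratio x y z w \<in> S"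
  then obtain x' y' z' where T: "x' \<in> T" "y' \<in> T" "z' \<in> T"
    and eqs: "x = f x'" "y = f y'" "z = f z'" by blast
  have f: "bij f" "\<And>a b c d. distinct [a, b, c, d] \<Longrightarrow>
      cross_ratio a b c d \<in> S \<longleftrightarrow> cross_ratio (f a) (f b) (f c) (f d) \<in> S"
    using assms unfolding cr_preserving_perms_def by blast+
  obtain w' where w: "w = f w'" using f(1) by (metis bij_pointE)
  have dist: "distinct [x', y', z', w']" using * eqs w by auto
  then have "cross_ratio x' y' z' w' \<in> S" using * f(2) eqs w by blast
  then show "w \<in> f ` T" using dist T w assms(2) unfolding cr_closed_def by blast
qed

text \<open>Images of closed sets are closed, so minimality of the hull gives one inclusion; the
  same argument for the inverse permutation gives the other.\<close>

lemma cr_hull_image: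
  assumes "f \<in> cr_preserving_perms S"
  shows "cr_hull S (f ` A) = f ` cr_hull S A"
proof
  show "cr_hull S (f ` A) \<subseteq> f ` cr_hull S A"
    using cr_hull_superset cr_closed_image[OF assms cr_closed_cr_hull]
    by (intro cr_hull_minimal image_mono)
  have bij: "bij f" using assms by (auto simp: cr_preserving_perms_def)
  have "A \<subseteq> inv_into UNIV f ` cr_hull S (f ` A)"
    using cr_hull_superset[of "f ` A" S] bij
    by (metis bij_is_inj image_inv_f_f image_mono)
  then have "cr_hull S A \<subseteq> inv_into UNIV f ` cr_hull S (f ` A)"
    using cr_closed_image[OF inv_in_cr_preserving_perms[OF assms] cr_closed_cr_hull]
    by (rule cr_hull_minimal)
  then show "f ` cr_hull S A \<subseteq> cr_hull S (f ` A)"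
    using bij by (metis bij_is_surj image_f_inv_f image_mono)
qed

section \<open>Hulls of three points as projective sublines\<close>

lemma cr_closed_proj_subline:
  assumes "type_subfield K" and "S \<subseteq> K"
  shows "cr_closed S (insert Infty (Pt ` K))"
  unfolding cr_closed_def
proof (intro ballI allI impI)
  interpret type_subfield K by fact
  fix p q r s
  assume mem: "p \<in> insert Infty (Pt ` K)" "q \<in> insert Infty (Pt ` K)" "r \<in> insert Infty (Pt ` K)"
    and dist: "distinct [p, q, r, s]" and "cross_ratio p q r s \<in> S"
  then have cr: "cross_ratio p q r s \<in> K" using assms(2) by blast
  define l where "l = cross_ratio p q r s"
  show "s \<in> insert Infty (Pt ` K)"
  proof (cases s)
    case s: (Pt v)
    have "v \<in> K"
    proof (cases p; cases q; cases r)
      fix x y z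
      assume *: "p = Pt x" "q = Pt y" "r = Pt z"
      \<comment> \<open>Removing the known factor from the cross-ratio leaves a linear equation for
        \<open>v\<close> with coefficients in \<open>K\<close>; it is solvable because
        \<open>x\<close> and \<open>y\<close> differ, so that \<open>k\<close> is not 1.\<close>
      define k where "k = l * ((z - y) / (z - x))"
      have k: "k = (v - y) / (v - x)"
        using * s dist by (auto simp: k_def l_def cross_ratio_def)
      then have "k \<noteq> 1" using * s dist by auto
      moreover have "k * (v - x) = v - y" using k * s dist by auto
      ultimately have "v = (y - k * x) / (1 - k)"
        by (simp add: field_simps)
      moreover have "k \<in> K" using cr mem * by (auto simp: k_def l_def intro!: closed)
      ultimately show "v \<in> K" using mem * by (auto intro!: closed)
    next
      fix x y
      assume *: "p = Pt x" "q = Pt y" "r = Infty"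
      have k: "l = (v - y) / (v - x)"
        using * s dist by (simp add: l_def cross_ratio_def)
      then have "l \<noteq> 1" using * s dist by auto
      moreover have "l * (v - x) = v - y" using k * s dist by auto
      ultimately have "v = (y - l * x) / (1 - l)"
        by (simp add: field_simps)
      then show "v \<in> K" using mem cr * l_def by (auto intro!: closed)
    next
      fix x z
      assume *: "p = Pt x" "q = Infty" "r = Pt z"
      have k: "l = (z - x) / (v - x)"
        using * s dist by (simp add: l_def cross_ratio_def)
      then have "v = x + (z - x) / l" using * s dist by auto
      then show "v \<in> K" using mem cr * l_def by (auto intro!: closed)
    next
      fix y z
      assume *: "p = Infty" "q = Pt y" "r = Pt z"
      have k: "l = (v - y) / (z - y)"
        using * s dist by (simp add: l_def cross_ratio_def)
      then have "v = y + l * (z - y)" using * s dist by auto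
      then show "v \<in> K" using mem cr * l_def by (auto intro!: closed)
    qed (use dist in auto)
    then show ?thesis using s by blast
  qed simp
qed

lemma cr_hull_standard_frame:
  fixes S :: "'a::field set"
  assumes "S \<subseteq> UNIV - {0, 1}" and "S \<noteq> {}"
  shows "cr_hull S {Infty, Pt 0, Pt 1} = insert Infty (Pt ` gen_subfield S)"
proof
  let ?H = "cr_hull S {Infty, Pt 0, Pt 1}"
  interpret K: type_subfield "gen_subfield S" by (rule type_subfield_gen_subfield)
  show "?H \<subseteq> insert Infty (Pt ` gen_subfield S)"
    by (intro cr_hull_minimal cr_closed_proj_subline type_subfield_gen_subfield gen_subfield_superset)
      (use K.closed in auto)
  define E where "E = {x. Pt x \<in> ?H}"
  have frame: "Infty \<in> ?H" "0 \<in> E" "1 \<in> E"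
    using cr_hull_superset[of "{Infty, Pt 0, Pt 1}" S] by (auto simp: E_def)
  have S: "x \<in> E" if "x \<in> S" for x
  proof -
    have "distinct [Infty, Pt 0, Pt 1, Pt x]" using assms that by auto
    moreover have "cross_ratio Infty (Pt 0) (Pt 1) (Pt x) \<in> S"
      using that by (simp add: cross_ratio_def)
    ultimately show ?thesis
      using frame cr_closed_cr_hull[of S "{Infty, Pt 0, Pt 1}"] unfolding cr_closed_def E_def by blast
  qed
  \<comment> \<open>A preserving map that sends the frame into the hull sends the whole hull into
    itself. Each closure property of \<open>E\<close> comes from one such linear fractional
    map.\<close>
  have move: "m ` ?H \<subseteq> ?H"
    if "m \<in> cr_preserving_perms S" and "m ` {Infty, Pt 0, Pt 1} \<subseteq> ?H" for m
    using cr_hull_minimal[OF that(2) cr_closed_cr_hull] cr_hull_image[OF that(1)] by blast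
  have mult: "c * x \<in> E" if "c \<in> E" "x \<in> E" for c x
  proof (cases "c = 0")
    case False
    have "frac_linear c 0 0 1 ` ?H \<subseteq> ?H"
      using False frame that
      by (intro move frac_linear_in_cr_preserving_perms) (auto simp: E_def)
    then have "frac_linear c 0 0 1 (Pt x) \<in> ?H" using that unfolding E_def by blast
    then show ?thesis by (simp add: E_def)
  qed (use frame in simp)
  have inv: "1 / x \<in> E" if "x \<in> E" for x
  proof (cases "x = 0")
    case False
    have "frac_linear 0 1 1 0 ` ?H \<subseteq> ?H"
      using frame by (intro move frac_linear_in_cr_preserving_perms) (auto simp: E_def)
    then have "frac_linear 0 1 1 0 (Pt x) \<in> ?H" using that unfolding E_def by blast
    then show ?thesis using False by (simp add: E_def)
  qed (use frame in simp)
  have compl: "1 - x \<in> E" if "x \<in> E" for x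
  proof -
    have "frac_linear (-1) 1 0 1 ` ?H \<subseteq> ?H"
      using frame by (intro move frac_linear_in_cr_preserving_perms) (auto simp: E_def)
    then have "frac_linear (-1) 1 0 1 (Pt x) \<in> ?H" using that unfolding E_def by blast
    then show ?thesis by (simp add: E_def)
  qed
  have div: "x / y \<in> E" if "x \<in> E" "y \<in> E" for x y
    using mult[OF that(1) inv[OF that(2)]] by simp
  \<comment> \<open>So far only products, quotients and \<open>1 - x\<close> are available. Any
    \<open>s\<close> in \<open>S\<close> yields \<open>1 / (s - 1)\<close> from these, and
    multiplying by \<open>1 - s\<close> gives -1.\<close>
  have neg_1: "-1 \<in> E"
  proof -
    obtain s where s: "s \<in> S" using assms(2) by blast
    then have "1 / (1 - 1 / s) / s \<in> E" using S by (intro div compl frame)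
    moreover have "1 / (1 - 1 / s) / s = - (1 / (1 - s))"
    proof -
      have "s \<noteq> 0" "s - 1 \<noteq> 0" "1 - s \<noteq> 0" using assms s by auto
      moreover have "1 - 1 / s = (s - 1) / s" using \<open>s \<noteq> 0\<close> by (simp add: field_simps)
      ultimately show ?thesis by (simp add: field_simps)
    qed
    ultimately have "- (1 / (1 - s)) * (1 - s) \<in> E" using S s by (simp only: mult compl)
    moreover have "1 - s \<noteq> 0" using assms s by auto
    ultimately show ?thesis by simp
  qed
  have diff: "x - y \<in> E" if "x \<in> E" "y \<in> E" for x y
  proof (cases "x = 0")
    case True
    then show ?thesis using mult[OF neg_1 that(2)] by simp
  next
    case False
    then have "x - y = x * (1 - y / x)" by (simp add: field_simps)
    then show ?thesis using that by (simp only: mult compl div)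
  qed
  have "type_subfield E" by unfold_locales (use frame diff div in auto)
  then have "gen_subfield S \<subseteq> E" using S by (intro gen_subfield_minimal) auto
  then show "insert Infty (Pt ` gen_subfield S) \<subseteq> ?H" using frame by (auto simp: E_def)
qed

text \<open>Moving \<open>p\<close>, \<open>q\<close>, \<open>r\<close> to the standard frame turns
  the cross-ratio into the coordinate of the fourth point. The relation given by the subfield is
  thus expressed through hulls, which \<open>S\<close>-preserving permutations respect.\<close>

lemma cross_ratio_in_gen_subfield_iff:
  fixes S :: "'a::field set"
  assumes "S \<subseteq> UNIV - {0, 1}" and "S \<noteq> {}" and dist: "distinct [p, q, r, s]"
  shows "cross_ratio p q r s \<in> gen_subfield S \<longleftrightarrow> s \<in> cr_hull S {p, q, r}"
proof -
  have "distinct [p, q, r]" using dist by simp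
  then obtain a b c d where det: "a * d - b * c \<noteq> 0" and pqr: "frac_linear a b c d p = Infty"
    "frac_linear a b c d q = Pt 0" "frac_linear a b c d r = Pt 1"
    by (rule frac_linear_normalize)
  define m where "m = frac_linear a b c d"
  have "bij m" using bij_frac_linear[OF det] by (simp add: m_def)
  then have inj: "inj m" by (rule bij_is_inj)
  have "m s \<noteq> Infty" using inj_eq[OF inj, of s p] dist pqr by (auto simp: m_def)
  then obtain w where w: "m s = Pt w" by (cases "m s") auto
  have "cross_ratio p q r s = w"
    using cross_ratio_frac_linear[OF det dist] pqr w by (simp add: m_def cross_ratio_def)
  moreover have "s \<in> cr_hull S {p, q, r} \<longleftrightarrow> m s \<in> m ` cr_hull S {p, q, r}"
    using inj by (simp add: inj_image_mem_iff)
  moreover have "m ` cr_hull S {p, q, r} = cr_hull S (m ` {p, q, r})"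
    unfolding m_def using frac_linear_in_cr_preserving_perms[OF det] by (rule cr_hull_image[symmetric])
  moreover have "m ` {p, q, r} = {Infty, Pt 0, Pt 1}" using pqr by (simp add: m_def)
  ultimately show ?thesis
    using cr_hull_standard_frame[OF assms(1,2)] w by auto
qed

lemma cr_preserving_perms_subset_gen_subfield:
  fixes S :: "'a::field set"
  assumes "S \<subseteq> UNIV - {0, 1}" and "S \<noteq> {}"
  shows "cr_preserving_perms S \<subseteq> cr_preserving_perms (gen_subfield S)"
proof
  fix f
  assume f: "f \<in> cr_preserving_perms S"
  then have inj: "inj f" and bij: "bij f" by (auto simp: cr_preserving_perms_def bij_is_inj)
  have "cross_ratio a b c d \<in> gen_subfield S \<longleftrightarrow>
      cross_ratio (f a) (f b) (f c) (f d) \<in> gen_subfield S" if dist: "distinct [a, b, c, d]" for a b c d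
  proof -
    have "distinct [f a, f b, f c, f d]" using dist by (auto simp: inj_eq[OF inj])
    moreover have "d \<in> cr_hull S {a, b, c} \<longleftrightarrow> f d \<in> cr_hull S {f a, f b, f c}"
      using cr_hull_image[OF f, of "{a, b, c}"] inj by (simp add: inj_image_mem_iff)
    ultimately show ?thesis
      using cross_ratio_in_gen_subfield_iff[OF assms] dist by simp
  qed
  then show "f \<in> cr_preserving_perms (gen_subfield S)"
    using bij by (auto simp: cr_preserving_perms_def)
qed

section \<open>Collineations are additive\<close>

text \<open>The quotient \<open>(z - x) / (y - x)\<close> is the cross-ratio of
  \<open>Infty\<close>, \<open>x\<close>, \<open>y\<close>, \<open>z\<close>; it lies in
  \<open>K\<close> exactly when \<open>z\<close> is on the \<open>K\<close>-line through
  \<open>x\<close> and \<open>y\<close>.\<close>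

locale collineation = type_subfield K for K :: "'a::field set" +
  fixes \<phi> :: "'a \<Rightarrow> 'a"
  assumes bij: "bij \<phi>"
    and zero [simp]: "\<phi> 0 = 0"
    and collinear: "distinct [x, y, z] \<Longrightarrow>
      (z - x) / (y - x) \<in> K \<longleftrightarrow> (\<phi> z - \<phi> x) / (\<phi> y - \<phi> x) \<in> K"
begin

lemma eq_iff [simp]: "\<phi> x = \<phi> y \<longleftrightarrow> x = y"
  using bij by (simp add: bij_is_inj inj_eq)

lemma eq_zero_iff [simp]: "\<phi> x = 0 \<longleftrightarrow> x = 0"
  using eq_iff[of x 0] by simp

text \<open>Parameters 0 and 1 give the points \<open>x\<close> and \<open>y\<close> themselves and
  are treated apart, since \<open>collinear\<close> speaks of three distinct points.\<close>

lemma line_image: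
  assumes "x \<noteq> y" "s \<in> K"
  obtains s' where "s' \<in> K" "\<phi> (x + s * (y - x)) = \<phi> x + s' * (\<phi> y - \<phi> x)"
proof (cases "s = 0 \<or> s = 1")
  case True
  then show thesis using that[OF zero_mem] that[OF one_mem] by auto
next
  case False
  let ?z = "x + s * (y - x)"
  have "?z - y = (s - 1) * (y - x)" by (simp add: algebra_simps)
  then have "distinct [x, y, ?z]" using False assms by auto
  moreover have "(?z - x) / (y - x) \<in> K" using assms by simp
  ultimately have "(\<phi> ?z - \<phi> x) / (\<phi> y - \<phi> x) \<in> K" using collinear by blast
  then show thesis using assms by (intro that) auto
qed

lemma line_preimage:
  assumes "x \<noteq> y" "s' \<in> K"
  obtains s where "s \<in> K" "\<phi> (x + s * (y - x)) = \<phi> x + s' * (\<phi> y - \<phi> x)"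
proof (cases "s' = 0 \<or> s' = 1")
  case True
  then show thesis using that[OF zero_mem] that[OF one_mem] by auto
next
  case False
  obtain z where z: "\<phi> z = \<phi> x + s' * (\<phi> y - \<phi> x)"
    using bij by (metis bij_pointE)
  have "\<phi> z - \<phi> y = (s' - 1) * (\<phi> y - \<phi> x)" using z by (simp add: algebra_simps)
  then have "\<phi> z \<noteq> \<phi> y" using False assms by auto
  moreover have "\<phi> z \<noteq> \<phi> x" using z False assms by auto
  ultimately have "distinct [x, y, z]" using assms by auto
  moreover have "(\<phi> z - \<phi> x) / (\<phi> y - \<phi> x) \<in> K" using assms z by simp
  ultimately have "(z - x) / (y - x) \<in> K" using collinear by blast
  moreover have "x + (z - x) / (y - x) * (y - x) = z" using assms by simp
  ultimately show thesis using z that by metis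
qed

lemma not_in_subfield_image:
  assumes "x \<noteq> 0" "y / x \<notin> K"
  shows "\<phi> y / \<phi> x \<notin> K"
proof -
  have "distinct [0, x, y]" using assms zero_mem one_mem by auto
  then show ?thesis using collinear[of 0 x y] assms by simp
qed

text \<open>The lines \<open>x + K y\<close> and \<open>K y\<close> are disjoint, and both meet two lines through \<open>t x\<close>. Hence their
  images are disjoint and coplanar, that is, parallel.\<close>

lemma parallel_image:
  assumes x: "x \<noteq> 0" and indep: "y / x \<notin> K" and t: "t \<in> K" "t \<noteq> 0" "t \<noteq> 1"
  obtains \<beta> where "\<beta> \<in> K" "\<phi> (x + y) = \<phi> x + \<beta> * \<phi> y"
proof -
  have y: "y \<noteq> 0" using indep zero_mem by auto
  \<comment> \<open>This choice puts \<open>x + y\<close> on the line through \<open>t * x\<close>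
    and \<open>s * y\<close>, whose images are multiples of \<open>\<phi> x\<close> and
    \<open>\<phi> y\<close>.\<close>
  define s where "s = t / (t - 1)"
  have s: "s \<in> K" "s \<noteq> 0" using t by (auto simp: s_def intro!: closed)
  obtain \<tau> where \<tau>: "\<tau> \<in> K" "\<phi> (t * x) = \<tau> * \<phi> x"
    using line_image[of 0 x t] x t by auto
  obtain \<sigma> where \<sigma>: "\<sigma> \<in> K" "\<phi> (s * y) = \<sigma> * \<phi> y"
    using line_image[of 0 y s] y s by auto
  have ne: "t * x \<noteq> s * y"
  proof
    assume "t * x = s * y"
    then have "y / x = t / s" using x s by (simp add: field_simps)
    then show False using indep t s divide_mem by auto
  qed
  have "t - 1 \<noteq> 0" using t by simp
  then have "x + y = t * x + (t - 1) / t * (s * y - t * x)"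
    using t by (simp add: s_def field_simps)
  moreover have "(t - 1) / t \<in> K" using t by (intro closed)
  ultimately obtain \<upsilon> where \<upsilon>: "\<upsilon> \<in> K"
    "\<phi> (x + y) = \<tau> * \<phi> x + \<upsilon> * (\<sigma> * \<phi> y - \<tau> * \<phi> x)"
    using line_image[OF ne, of "(t - 1) / t"] \<tau> \<sigma> by metis
  define \<alpha> where "\<alpha> = \<tau> - \<upsilon> * \<tau>"
  define \<beta> where "\<beta> = \<upsilon> * \<sigma>"
  have mem: "\<alpha> \<in> K" "\<beta> \<in> K" using \<tau> \<sigma> \<upsilon> by (auto simp: \<alpha>_def \<beta>_def intro!: closed)
  have eq: "\<phi> (x + y) = \<alpha> * \<phi> x + \<beta> * \<phi> y"
    using \<upsilon> by (simp add: \<alpha>_def \<beta>_def algebra_simps)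
  have "\<alpha> = 1"
  proof (rule ccontr)
    assume "\<alpha> \<noteq> 1"
    \<comment> \<open>At parameter \<open>r\<close> the line through \<open>\<phi> x\<close> and
      \<open>\<phi> (x + y)\<close> has no \<open>\<phi> x\<close> component, so it meets the line
      \<open>K * \<phi> y\<close>. The preimage of this point would lie on both
      \<open>x + K y\<close> and \<open>K y\<close>.\<close>
    define r where "r = 1 / (1 - \<alpha>)"
    have r: "r \<in> K" "r * (1 - \<alpha>) = 1" using mem \<open>\<alpha> \<noteq> 1\<close> by (auto simp: r_def intro!: closed)
    have "r * \<beta> \<in> K" using r mem by (intro closed)
    obtain u where u: "u \<in> K" "\<phi> (x + u * y) = \<phi> x + r * (\<phi> (x + y) - \<phi> x)"
      using line_preimage[of x "x + y" r] y r by auto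
    have "\<phi> x + r * (\<phi> (x + y) - \<phi> x) = \<phi> x - r * (1 - \<alpha>) * \<phi> x + r * \<beta> * \<phi> y"
      unfolding eq by (simp add: algebra_simps)
    also have "\<dots> = r * \<beta> * \<phi> y" using r by simp
    finally have 1: "\<phi> (x + u * y) = r * \<beta> * \<phi> y" using u by simp
    obtain v where v: "v \<in> K" "\<phi> (v * y) = r * \<beta> * \<phi> y"
      using line_preimage[of 0 y "r * \<beta>"] y \<open>r * \<beta> \<in> K\<close> by auto
    have "x + u * y = v * y" using 1 v by (metis eq_iff)
    then have "x = (v - u) * y" by (simp add: algebra_simps)
    then have "y / x = 1 / (v - u)" using x y by simp
    then show False using indep u v by (auto intro!: closed)
  qed
  then show thesis using that mem eq by simp
qed

text \<open>\<open>parallel_image\<close> is applied to \<open>x\<close>, \<open>y\<close> and with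
  the roles exchanged. Since the images are independent over \<open>K\<close>, comparing the two
  expressions forces the coefficient \<open>\<beta>\<close> to be 1.\<close>

lemma additive_of_independent:
  assumes x: "x \<noteq> 0" and indep: "y / x \<notin> K" and t: "t \<in> K" "t \<noteq> 0" "t \<noteq> 1"
  shows "\<phi> (x + y) = \<phi> x + \<phi> y"
proof -
  have y: "y \<noteq> 0" using indep zero_mem by auto
  have "x / y \<notin> K" using divide_mem[OF one_mem, of "x / y"] indep by auto
  then obtain \<gamma> where \<gamma>: "\<gamma> \<in> K" "\<phi> (x + y) = \<phi> y + \<gamma> * \<phi> x"
    using parallel_image[OF y _ t, of x] by (metis add.commute)
  obtain \<beta> where \<beta>: "\<beta> \<in> K" "\<phi> (x + y) = \<phi> x + \<beta> * \<phi> y"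
    using parallel_image[OF x indep t] by metis
  have "(1 - \<beta>) * \<phi> y = (1 - \<gamma>) * \<phi> x" using \<beta> \<gamma> by (simp add: algebra_simps)
  moreover have "\<phi> y / \<phi> x \<notin> K" using not_in_subfield_image[OF x indep] .
  moreover have "\<phi> y / \<phi> x = (1 - \<gamma>) / (1 - \<beta>)" if "\<beta> \<noteq> 1"
    using calculation(1) that x by (simp add: frac_eq_eq mult.commute)
  ultimately have "\<beta> = 1"
    using \<beta> \<gamma> by (metis divide_mem diff_mem one_mem)
  then show ?thesis using \<beta> by simp
qed

text \<open>For dependent \<open>x\<close> and \<open>y\<close>, some \<open>z\<close> outside
  \<open>K * x\<close> exists because \<open>K\<close> is proper. Evaluating at
  \<open>x + y + z\<close> with both bracketings uses only independent sums, and
  \<open>\<phi> z\<close> cancels.\<close>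

lemma additive:
  assumes t: "t \<in> K" "t \<noteq> 0" "t \<noteq> 1" and "K \<noteq> UNIV"
  shows "\<phi> (x + y) = \<phi> x + \<phi> y"
proof (cases "x = 0 \<or> y = 0 \<or> y / x \<notin> K")
  case True
  then show ?thesis using additive_of_independent[OF _ _ t, of x y] by (cases "x = 0"; cases "y = 0") auto
next
  case False
  then have x: "x \<noteq> 0" and y: "y \<noteq> 0" and yx: "y / x \<in> K" by auto
  obtain w where w: "w \<notin> K" using assms by blast
  define z where "z = x * w"
  have z: "z / x \<notin> K" using x w by (simp add: z_def)
  have "z / y \<notin> K"
  proof
    assume "z / y \<in> K"
    then have "z / y * (y / x) \<in> K" using yx by (rule mult_mem)
    then show False using z y by simp
  qed
  then have yz: "\<phi> (y + z) = \<phi> y + \<phi> z" using additive_of_independent[OF y _ t] by blast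
  have "(y + z) / x \<notin> K"
  proof
    assume "(y + z) / x \<in> K"
    then have "(y + z) / x - y / x \<in> K" using yx by (rule diff_mem)
    then show False using z by (simp add: add_divide_distrib)
  qed
  then have 1: "\<phi> (x + (y + z)) = \<phi> x + (\<phi> y + \<phi> z)"
    using additive_of_independent[OF x _ t] yz by simp
  have "\<phi> ((x + y) + z) = \<phi> (x + y) + \<phi> z"
  proof (cases "x + y = 0")
    case False
    have "z / (x + y) \<notin> K"
    proof
      assume "z / (x + y) \<in> K"
      moreover have "1 + y / x \<in> K" using one_mem yx by (rule add_mem)
      ultimately have "z / (x + y) * (1 + y / x) \<in> K" by (rule mult_mem)
      moreover have "1 + y / x = (x + y) / x" using x by (simp add: field_simps)
      ultimately show False using z False by simp
    qed
    then show ?thesis using additive_of_independent[OF False _ t] by blast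
  qed simp
  then show ?thesis using 1 by (simp add: add.assoc[symmetric])
qed

end

section \<open>Additive maps compatible with inversion\<close>

text \<open>Hua's identity shows that \<open>\<psi>\<close> equals \<open>\<phi>\<close> and that
  \<open>\<phi> (a ^ 2 * b) = \<phi> a ^ 2 * \<phi> b\<close>. Full multiplicativity follows from
  surjective squaring in characteristic 2 and from polarization otherwise.\<close>

lemma field_aut_of_additive_inversion:
  fixes \<phi> :: "'a::field \<Rightarrow> 'a"
  assumes bij: "bij \<phi>" and one: "\<phi> 1 = 1"
    and add: "\<And>x y. \<phi> (x + y) = \<phi> x + \<phi> y"
    and add': "\<And>x y. 1 / \<phi> (1 / (x + y)) = 1 / \<phi> (1 / x) + 1 / \<phi> (1 / y)"
    and perfect: "CHAR('a) = 2 \<Longrightarrow> surj (\<lambda>x::'a. x ^ 2)"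
  shows "\<phi> \<in> field_auts"
proof -
  define \<psi> where "\<psi> x = 1 / \<phi> (1 / x)" for x
  have zero [simp]: "\<phi> 0 = 0" using add[of 0 0] by (metis add_0 add_cancel_right_right)
  have diff: "\<phi> (x - y) = \<phi> x - \<phi> y" for x y using add[of "x - y" y] by simp
  have eq0 [simp]: "\<phi> x = 0 \<longleftrightarrow> x = 0" for x
    using bij zero by (metis bij_is_inj inj_eq)
  have psi_add: "\<psi> (x + y) = \<psi> x + \<psi> y" for x y using add' by (simp add: \<psi>_def)
  have psi_diff: "\<psi> (x - y) = \<psi> x - \<psi> y" for x y using psi_add[of "x - y" y] by simp
  have psi_inv: "\<psi> (1 / x) = 1 / \<phi> x" for x by (simp add: \<psi>_def)
  have phi_inv: "\<phi> (1 / x) = 1 / \<psi> x" for x by (simp add: \<psi>_def)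
  have psi_1: "\<psi> 1 = 1" by (simp add: \<psi>_def one)
  have psi_0 [simp]: "\<psi> x = 0 \<longleftrightarrow> x = 0" for x by (simp add: \<psi>_def)
  text \<open>Hua's identity \<open>a - 1 / (1 / a + 1 / (1 / b - a)) = a\<^sup>2 b\<close>, to which the additive map \<open>\<psi>\<close> is
    applied; the two maps are exchanged at each inversion.\<close>
  have hua: "\<psi> (a ^ 2 * b) = \<psi> a ^ 2 * \<phi> b" for a b
  \<comment> \<open>These are the cases in which Hua's identity would invert 0. If
    \<open>a * b = 1\<close>, then \<open>a ^ 2 * b = a\<close> and
    \<open>\<phi> b = 1 / \<psi> a\<close>.\<close>
  proof (cases "a = 0 \<or> b = 0 \<or> a * b = 1")
    case True
    have "\<psi> (a ^ 2 * b) = \<psi> a ^ 2 * \<phi> b" if "a * b = 1"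
    proof -
      have "a \<noteq> 0" "b = 1 / a" using that by (auto simp: eq_divide_eq mult.commute)
      then show ?thesis by (simp add: phi_inv power2_eq_square)
    qed
    moreover have "\<psi> 0 = 0" "\<phi> 0 = 0" by (simp_all only: psi_0 zero)
    ultimately show ?thesis using True by (elim disjE) (simp_all del: psi_0)
  next
    case False
    have id: "a - 1 / (1 / a + 1 / (1 / b - a)) = a ^ 2 * b"
      if "a \<noteq> 0" "b \<noteq> 0" "1 / b - a \<noteq> 0" for a b :: 'a
    proof -
      have "1 / a + 1 / (1 / b - a) = 1 / (a * b * (1 / b - a))"
        using that by (simp add: add_frac_eq)
      then have "1 / (1 / a + 1 / (1 / b - a)) = a * b * (1 / b - a)" by simp
      then show ?thesis using that by (simp add: right_diff_distrib power2_eq_square)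
    qed
    have ne: "1 / b - a \<noteq> 0" using False by (auto simp: field_simps)
    then have "\<psi> (1 / b - a) \<noteq> 0" by simp
    then have ne': "1 / \<phi> b - \<psi> a \<noteq> 0" by (simp only: psi_diff psi_inv not_False_eq_True)
    have "\<psi> (a ^ 2 * b) = \<psi> a - 1 / (\<phi> (1 / a) + \<phi> (1 / (1 / b - a)))"
      using id[of a b] False ne psi_diff psi_inv add by metis
    also have "\<dots> = \<psi> a - 1 / (1 / \<psi> a + 1 / (1 / \<phi> b - \<psi> a))"
      by (simp only: phi_inv psi_diff psi_inv)
    also have "\<dots> = \<psi> a ^ 2 * \<phi> b"
      using id[of "\<psi> a" "\<phi> b"] False ne' by simp
    finally show ?thesis .
  qed
  have "\<psi> b = \<phi> b" for b using hua[of 1 b] psi_1 by simp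
  then have sq_mult: "\<phi> (a ^ 2 * b) = \<phi> a ^ 2 * \<phi> b" for a b using hua by simp
  then have sq: "\<phi> (a ^ 2) = \<phi> a ^ 2" for a using sq_mult[of a 1] one by simp
  have "\<phi> (x * y) = \<phi> x * \<phi> y" for x y
  proof (cases "CHAR('a) = 2")
    case True
    then obtain z where "x = z ^ 2" using perfect by (metis surjD)
    then show ?thesis using sq_mult sq by simp
  next
    case False
    have two: "(2::'a) \<noteq> 0"
    proof
      assume "(2::'a) = 0"
      then have "of_nat 2 = (0::'a)" by simp
      then have "CHAR('a) dvd 2" by (simp only: of_nat_eq_0_iff_char_dvd)
      then have "CHAR('a) \<le> 2" by (rule dvd_imp_le) simp
      moreover have "CHAR('a) \<noteq> 0" using \<open>CHAR('a) dvd 2\<close> by (intro notI) simp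
      moreover have "CHAR('a) \<noteq> 1" by simp
      ultimately show False using False by linarith
    qed
    \<comment> \<open>Polarization: \<open>\<phi>\<close> respects squares and sums, hence twice a
      product, and 2 is invertible.\<close>
    have "(x + y) ^ 2 = (x ^ 2 + y ^ 2) + (x * y + x * y)"
      by (simp add: power2_eq_square algebra_simps)
    then have "\<phi> ((x + y) ^ 2) = \<phi> x ^ 2 + \<phi> y ^ 2 + (\<phi> (x * y) + \<phi> (x * y))"
      by (simp only: add sq)
    moreover have "\<phi> ((x + y) ^ 2) = \<phi> x ^ 2 + \<phi> y ^ 2 + 2 * (\<phi> x * \<phi> y)"
      by (simp only: add sq) (simp add: power2_eq_square algebra_simps)
    ultimately have "2 * \<phi> (x * y) = 2 * (\<phi> x * \<phi> y)"
      by (simp only: mult_2 add_left_cancel)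
    then show ?thesis using two by (simp only: mult_left_cancel not_False_eq_True)
  qed
  then show ?thesis using bij one add by (simp add: field_auts_iff)
qed

section \<open>Permutations fixing the standard frame\<close>

lemma cr_preserving_fixing_frame:
  fixes K :: "'a::field set"
  assumes sub: "type_subfield K" and f: "f \<in> cr_preserving_perms K"
    and frame: "f Infty = Infty" "f (Pt 0) = Pt 0"
    and \<phi>: "\<And>x. f (Pt x) = Pt (\<phi> x)"
  shows "collineation K \<phi>"
proof -
  interpret type_subfield K by fact
  have bij: "bij f" and cr: "\<And>a b c d. distinct [a, b, c, d] \<Longrightarrow>
      cross_ratio a b c d \<in> K \<longleftrightarrow> cross_ratio (f a) (f b) (f c) (f d) \<in> K"
    using f unfolding cr_preserving_perms_def by blast+
  show ?thesis
  proof
    show "bij \<phi>"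
    proof (rule bijI)
      show "inj \<phi>" by (rule injI) (metis \<phi> bij bij_is_inj inj_eq proj_line.inject)
      have "\<exists>x. y = \<phi> x" for y
      proof -
        obtain p where "Pt y = f p" using bij by (metis bij_pointE)
        then show ?thesis using \<phi> frame by (cases p) auto
      qed
      then show "surj \<phi>" by (simp add: surj_def)
    qed
    show "\<phi> 0 = 0" using frame \<phi>[of 0] by simp
    show "(z - x) / (y - x) \<in> K \<longleftrightarrow> (\<phi> z - \<phi> x) / (\<phi> y - \<phi> x) \<in> K"
      if "distinct [x, y, z]" for x y z
      using cr[of Infty "Pt x" "Pt y" "Pt z"] that \<phi> frame by (simp add: cross_ratio_def)
  qed
qed

lemma cr_preserving_fixing_frame_is_aut:
  fixes K :: "'a::field set"
  assumes sub: "type_subfield K" and t: "t \<in> K" "t \<noteq> 0" "t \<noteq> 1" and proper: "K \<noteq> UNIV"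
    and perfect: "CHAR('a) = 2 \<Longrightarrow> surj (\<lambda>x::'a. x ^ 2)"
    and f: "f \<in> cr_preserving_perms K"
    and frame: "f Infty = Infty" "f (Pt 0) = Pt 0" "f (Pt 1) = Pt 1"
  obtains \<sigma> where "\<sigma> \<in> field_auts" "f = map_proj_line \<sigma>"
proof -
  have bij: "bij f" using f by (simp add: cr_preserving_perms_def)
  \<comment> \<open>Being injective and fixing \<open>Infty\<close>, \<open>f\<close> sends finite
    points to finite points, so the description has a unique value.\<close>
  define \<phi> where "\<phi> x = (THE y. f (Pt x) = Pt y)" for x
  have \<phi>: "f (Pt x) = Pt (\<phi> x)" for x
  proof -
    have "f (Pt x) \<noteq> Infty" using bij frame by (metis bij_is_inj inj_eq proj_line.distinct(1))
    then show ?thesis by (cases "f (Pt x)") (auto simp: \<phi>_def)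
  qed
  interpret c: collineation K \<phi>
    using cr_preserving_fixing_frame[OF sub f] frame \<phi> by blast
  define J where "J = frac_linear 0 1 1 (0 :: 'a)"
  have J: "J \<in> cr_preserving_perms K"
    unfolding J_def by (rule frac_linear_in_cr_preserving_perms) simp
  have J_simps: "J Infty = Pt 0" "J (Pt x) = (if x = 0 then Infty else Pt (1 / x))" for x
    by (auto simp: J_def)
  \<comment> \<open>Conjugation by the inversion \<open>J\<close> keeps \<open>Infty\<close> and 0
    fixed. As \<open>1 / 0 = 0\<close>, the formula is also correct at \<open>x = 0\<close>.\<close>
  interpret d: collineation K "\<lambda>x. 1 / \<phi> (1 / x)"
  proof (rule cr_preserving_fixing_frame[OF sub, of "J \<circ> f \<circ> J"])
    show "J \<circ> f \<circ> J \<in> cr_preserving_perms K" by (intro comp_in_cr_preserving_perms J f)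
  qed (auto simp: J_simps frame \<phi>)
  have "\<phi> \<in> field_auts"
    using c.bij c.additive[OF t proper] d.additive[OF t proper] perfect frame(3) \<phi>[of 1]
    by (intro field_aut_of_additive_inversion) auto
  moreover have "f = map_proj_line \<phi>"
  proof
    show "f p = map_proj_line \<phi> p" for p by (cases p) (auto simp: frame \<phi>)
  qed
  ultimately show thesis by (rule that)
qed

text \<open>A field automorphism commutes with the formation of cross-ratios, so invariance of
  \<open>S\<close> gives invariance of the relation.\<close>

lemma map_proj_line_in_cr_preserving_perms:
  assumes \<sigma>: "\<sigma> \<in> field_auts" and S: "\<sigma> ` S = S"
  shows "map_proj_line \<sigma> \<in> cr_preserving_perms (S :: 'a::field set)"
proof -
  have bij: "bij \<sigma>" and add: "\<And>x y. \<sigma> (x + y) = \<sigma> x + \<sigma> y"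
    and mult: "\<And>x y. \<sigma> (x * y) = \<sigma> x * \<sigma> y" and one: "\<sigma> 1 = 1"
    using \<sigma> unfolding field_auts_iff by blast+
  have zero: "\<sigma> 0 = 0" using add[of 0 0] by (metis add_0 add_cancel_right_right)
  have diff: "\<sigma> (x - y) = \<sigma> x - \<sigma> y" for x y using add[of "x - y" y] by simp
  have eq0: "\<sigma> x = 0 \<longleftrightarrow> x = 0" for x using bij zero by (metis bij_is_inj inj_eq)
  have div: "\<sigma> (x / y) = \<sigma> x / \<sigma> y" for x y
    using mult[of "x / y" y] by (cases "y = 0") (simp_all add: zero eq0 eq_divide_eq)
  have factor: "cr_factor (map_proj_line \<sigma> p) (map_proj_line \<sigma> q) = \<sigma> (cr_factor p q)" for p q
    by (cases p; cases q) (auto simp: diff one)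
  have cr: "cross_ratio (map_proj_line \<sigma> p) (map_proj_line \<sigma> q) (map_proj_line \<sigma> r) (map_proj_line \<sigma> s)
      = \<sigma> (cross_ratio p q r s)" for p q r s
    by (simp add: cross_ratio_def factor mult div)
  have "x \<in> S \<longleftrightarrow> \<sigma> x \<in> S" for x
    using S bij by (metis bij_is_inj inj_image_mem_iff)
  moreover have "bij (map_proj_line \<sigma>)"
  proof (rule o_bij)
    have "(map_proj_line (inv_into UNIV \<sigma>) \<circ> map_proj_line \<sigma>) p = p" for p
      using bij by (cases p) (simp_all add: bij_is_inj)
    then show "map_proj_line (inv_into UNIV \<sigma>) \<circ> map_proj_line \<sigma> = id" by (intro ext) simp
    have "(map_proj_line \<sigma> \<circ> map_proj_line (inv_into UNIV \<sigma>)) p = p" for p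
      using bij by (cases p) (simp_all add: bij_is_surj surj_f_inv_f)
    then show "map_proj_line \<sigma> \<circ> map_proj_line (inv_into UNIV \<sigma>) = id" by (intro ext) simp
  qed
  ultimately show ?thesis by (simp add: cr_preserving_perms_def cr)
qed

theorem corollary2p15:
  fixes S :: "'a::field set"
  assumes "S \<subseteq> UNIV - {0, 1}"
    and "S \<noteq> {}"
    and "aut_invariant S"
    and "gen_subfield S \<subset> UNIV"
    and "CHAR('a) = 2 \<Longrightarrow>
           perfect_field TYPE('a) \<and> (infinite (UNIV :: 'a set) \<or> card (UNIV :: 'a set) > 4)"
  shows "cr_preserving_perms S = PGammaL2"
proof
  show "PGammaL2 \<subseteq> cr_preserving_perms S"
    using assms(3) by (auto simp: PGammaL2_def aut_invariant_def intro!: comp_in_cr_preserving_perms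
        frac_linear_in_cr_preserving_perms map_proj_line_in_cr_preserving_perms)
  show "cr_preserving_perms S \<subseteq> PGammaL2"
  proof
    fix f
    assume f: "f \<in> cr_preserving_perms S"
    then have "inj f" by (auto simp: cr_preserving_perms_def bij_is_inj)
    then have "distinct [f Infty, f (Pt 0), f (Pt 1)]" by (auto simp: inj_eq)
    then obtain a b c d where det: "a * d - b * c \<noteq> 0"
      and frame: "frac_linear a b c d (f Infty) = Infty"
        "frac_linear a b c d (f (Pt 0)) = Pt 0" "frac_linear a b c d (f (Pt 1)) = Pt 1"
      by (rule frac_linear_normalize)
    \<comment> \<open>An element of \<open>S\<close> serves as the scalar other than 0 and 1 that
      the additivity argument requires.\<close>
    obtain t where t: "t \<in> S" using assms(2) by blast
    then have t': "t \<in> gen_subfield S" "t \<noteq> 0" "t \<noteq> 1"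
      using assms(1) gen_subfield_superset by auto
    have perfect: "surj (\<lambda>x::'a. x ^ 2)" if "CHAR('a) = 2"
      using assms(5)[OF that] that by (simp add: perfect_field_def)
    have g: "frac_linear a b c d \<circ> f \<in> cr_preserving_perms (gen_subfield S)"
      using f cr_preserving_perms_subset_gen_subfield[OF assms(1,2)]
      by (intro comp_in_cr_preserving_perms frac_linear_in_cr_preserving_perms det) auto
    obtain \<sigma> where \<sigma>: "\<sigma> \<in> field_auts" "frac_linear a b c d \<circ> f = map_proj_line \<sigma>"
    proof (rule cr_preserving_fixing_frame_is_aut[OF type_subfield_gen_subfield t' _ perfect g])
      show "gen_subfield S \<noteq> UNIV" using assms(4) by blast
    qed (use frame in auto)
    \<comment> \<open>The normalizing map is undone by its adjugate matrix.\<close>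
    have "f = frac_linear d (- b) (- c) a \<circ> map_proj_line \<sigma>"
      unfolding \<sigma>(2)[symmetric] using frac_linear_inverse[OF det] by (simp add: fun_eq_iff)
    moreover have "d * a - (- b) * (- c) \<noteq> 0" using det by (simp add: mult.commute)
    ultimately show "f \<in> PGammaL2" using \<sigma>(1) unfolding PGammaL2_def by blast
  qed
qed

end
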